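(* Let $\mathbb{K}$ be an algebraically closed field and let $f$ be the Pfaffian of a generic $6\times 6$ skew-symmetric matrix, regarded as a cubic form over $\mathbb{K}$ in the $15$ entries above the diagonal. Then $\mathbf{pr}(f)\geq 7$.
   Context: The product rank $\mathbf{pr}(f)$ of a degree $d$ form $f$ is the smallest number $r$ such that $f=\boldsymbol{\ell}_1+\dots+\boldsymbol{\ell}_r$ where each $\boldsymbol{\ell}_i$ is a product of $d$ linear forms. A generic skew-symmetric matrix has independent variables as its entries above the diagonal. *)

theory Defs
  imports
    "HOL-Library.Poly_Mapping"
    "HOL-Computational_Algebra.Polynomial"
    "HOL-Combinatorics.Permutations"
begin

text \<open>
  Multivariate polynomials with coefficients in \<open>'a\<close> and variables indexed by \<open>'v\<close>:
  finitely supported functions on exponent vectors, with the ring structure from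
  \<^theory>\<open>HOL-Library.Poly_Mapping\<close>.
\<close>

type_synonym ('v, 'a) mpoly = "('v \<Rightarrow>\<^sub>0 nat) \<Rightarrow>\<^sub>0 'a"

definition Const :: "'a::comm_ring_1 \<Rightarrow> ('v, 'a) mpoly" where
  "Const c = Poly_Mapping.single 0 c"

definition Var :: "'v \<Rightarrow> ('v, 'a::comm_ring_1) mpoly" where
  "Var v = Poly_Mapping.single (Poly_Mapping.single v 1) 1"

definition linear_form :: "'v set \<Rightarrow> ('v, 'a::comm_ring_1) mpoly \<Rightarrow> bool" where
  "linear_form V l \<longleftrightarrow> (\<exists>c. l = (\<Sum>v\<in>V. Const (c v) * Var v))"

definition product_of_linear_forms :: "'v set \<Rightarrow> nat \<Rightarrow> ('v, 'a::comm_ring_1) mpoly \<Rightarrow> bool" where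
  "product_of_linear_forms V d g \<longleftrightarrow>
     (\<exists>l. (\<forall>j<d. linear_form V (l j)) \<and> g = (\<Prod>j<d. l j))"

text \<open>
  The product rank of a form \<open>f\<close> of degree \<open>d\<close> in the finite set \<open>V\<close> of variables. For \<open>d \<ge> 1\<close>
  such an \<open>r\<close> always exists over a field, since every term of \<open>f\<close> is a product of \<open>d\<close> linear forms.
\<close>

definition product_rank :: "'v set \<Rightarrow> nat \<Rightarrow> ('v, 'a::field) mpoly \<Rightarrow> nat" where
  "product_rank V d f =
     (LEAST r. \<exists>g. (\<forall>i<r. product_of_linear_forms V d (g i)) \<and> f = (\<Sum>i<r. g i))"

text \<open>
  The Pfaffian of a skew-symmetric matrix of size \<open>2n\<close>, with rows and columns indexed from \<open>0\<close>.
  The sum runs over the perfect matchings of the index set, each written uniquely as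
  \<open>{p 0, p 1}, {p 2, p 3}, \<dots>\<close> with \<open>p 0 < p 1\<close>, \<open>p 2 < p 3\<close>, \<open>\<dots>\<close> and \<open>p 0 < p 2 < \<dots>\<close>; unlike the sum
  over all permutations divided by \<open>2\<^sup>n n!\<close>, this makes sense in every characteristic.
\<close>

definition matching_perms :: "nat \<Rightarrow> (nat \<Rightarrow> nat) set" where
  "matching_perms n = {p. p permutes {..<2*n} \<and>
     (\<forall>i<n. p (2*i) < p (2*i + 1)) \<and>
     (\<forall>i j. i < j \<and> j < n \<longrightarrow> p (2*i) < p (2*j))}"

definition pfaffian :: "nat \<Rightarrow> (nat \<Rightarrow> nat \<Rightarrow> 'a::comm_ring_1) \<Rightarrow> 'a" where
  "pfaffian n A = (\<Sum>p\<in>matching_perms n. of_int (sign p) * (\<Prod>i<n. A (p (2*i)) (p (2*i + 1))))"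

definition upper_entries :: "nat \<Rightarrow> (nat \<times> nat) set" where
  "upper_entries m = {(i, j). i < j \<and> j < m}"

definition generic_skew :: "nat \<Rightarrow> nat \<Rightarrow> (nat \<times> nat, 'a::comm_ring_1) mpoly" where
  "generic_skew i j = (if i < j then Var (i, j) else if j < i then - Var (j, i) else 0)"

end

theory Submission
  imports Defs "HOL-Analysis.Cartesian_Space"
begin

text \<open>
  Suppose that the Pfaffian is a sum of six products of three linear forms. The 18 forms embed the space of
  skew matrices into \<open>K\<^sup>1\<^sup>8\<close>, because the Pfaffian depends on all its variables. For a vector \<open>v\<close> the skew
  matrices \<open>\<omega>\<close> with \<open>\<omega> v = 0\<close> form a space of dimension 10 on which the Pfaffian vanishes, so its
  image \<open>W\<close> lies on the cubic \<open>(\<Sum>i. x\<^sub>i y\<^sub>i z\<^sub>i) = 0\<close>; for general \<open>v\<close> none of the nonzero forms vanishes on \<open>W\<close>. Pick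
  \<open>w \<in> W\<close> with nonzero coordinates. Polarizing, \<open>W\<close> is totally isotropic for the quadratic form
  \<open>\<Sum>i. w\<^sub>i\<^sub>1 y\<^sub>i z\<^sub>i + w\<^sub>i\<^sub>2 x\<^sub>i z\<^sub>i + w\<^sub>i\<^sub>3 x\<^sub>i y\<^sub>i\<close>. Outside characteristic 2 its polar form is nondegenerate, hence
  \<open>dim W \<le> 9\<close>, a contradiction. In characteristic 2 the polar form has a radical of dimension 6, but
  a Frobenius argument shows that \<open>W\<close> meets it in dimension at most 3, and \<open>dim W \<le> 6 + 3\<close> follows.
\<close>

subsection \<open>Isotropic subspaces\<close>

lemma vec_linearI:
  fixes f :: "'a::field ^ 'm \<Rightarrow> 'a ^ 'n"
  assumes "\<And>x y. f (x + y) = f x + f y" "\<And>c x. f (c *s x) = c *s f x"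
  shows "Vector_Spaces.linear (*s) (*s) f"
  using assms by unfold_locales (auto simp: vec.scale_right_distrib vec.scale_left_distrib)

text \<open>Extend a basis \<open>B\<close> inside \<open>U\<close> to a basis \<open>C\<close> of
  the whole space. A vector of \<open>U'\<close> has zero product with \<open>B\<close>, so by
  nondegeneracy of the dot product it is determined by its products with \<open>C - B\<close>; the
  map \<open>f\<close> records these as coefficients. Only \<open>U'\<close> must be a subspace, so
  \<open>U\<close> may also be just the image of a basis.\<close>

lemma vec_dim_annihilator_le:
  fixes U U' :: "('a::field ^ 'n) set"
  assumes sub: "vec.subspace U'"
    and orth: "\<And>x y. x \<in> U \<Longrightarrow> y \<in> U' \<Longrightarrow> (\<Sum>i\<in>UNIV. x $ i * y $ i) = 0"
  shows "vec.dim U + vec.dim U' \<le> CARD('n)"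
proof -
  obtain B where B: "B \<subseteq> U" "vec.independent B" "card B = vec.dim U"
    using vec.basis_exists by metis
  obtain C where C: "B \<subseteq> C" "vec.independent C" "UNIV \<subseteq> vec.span C"
    using vec.maximal_independent_subset_extend[of B UNIV] B(2) by auto
  have finC: "finite C" using C(2) by (rule vec.finiteI_independent)
  have cardC: "card C = CARD('n)"
    using vec.basis_card_eq_dim[of C UNIV] C vec_dim_card by (metis subset_UNIV)
  define dot where "dot x y = (\<Sum>i\<in>UNIV. x $ i * y $ i)" for x y :: "'a ^ 'n"
  define f where "f y = (\<Sum>c\<in>C - B. dot c y *s c)" for y
  have dot_add: "dot x (y + z) = dot x y + dot x z" for x y z
    by (simp add: dot_def distrib_left sum.distrib)
  have dot_scale: "dot x (c *s y) = c * dot x y" for x y c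
    by (simp add: dot_def sum_distrib_left mult_ac)
  have lin: "Vector_Spaces.linear (*s) (*s) f"
    by (rule vec_linearI)
       (simp_all add: f_def dot_add dot_scale vec.scale_left_distrib sum.distrib vec.scale_sum_right)
  interpret f: Vector_Spaces.linear "(*s)" "(*s)" f by (rule lin)
  have inj: "inj_on f U'"
  proof (subst f.inj_on_iff_eq_0[OF sub], safe)
    fix y assume y: "y \<in> U'" "f y = 0"
    have "dot c y = 0" if "c \<in> C" for c
    proof (cases "c \<in> B")
      case True
      then show ?thesis using B(1) orth y(1) by (auto simp: dot_def)
    next
      case False
      have "vec.independent (C - B)" using C(2) by (rule vec.independent_mono) auto
      then show ?thesis using False that y(2) unfolding vec.independent_explicit f_def by auto
    qed
    have *: "dot c y = 0" if "c \<in> vec.span C" for c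
      using that \<open>\<And>c. c \<in> C \<Longrightarrow> dot c y = 0\<close>
      by (induction rule: vec.span_induct_alt)
         (auto simp: dot_def distrib_right sum.distrib sum_distrib_left[symmetric] mult.assoc)
    have "y $ i = 0" for i
    proof -
      have "dot (axis i 1) y = y $ i"
        by (simp add: dot_def axis_def if_distrib[of "\<lambda>u. u * _"] cong: if_cong)
      then show ?thesis using * C(3) by (metis UNIV_I subsetD)
    qed
    then show "y = 0" by (simp add: vec_eq_iff)
  qed
  have "vec.dim U' = vec.dim (f ` U')"
    using vec.dim_image_eq[OF lin, of U'] inj sub by (simp add: vec.span_eq_iff[THEN iffD2])
  also have "\<dots> \<le> card (C - B)"
    using finC by (intro vec.dim_le_card) (auto simp: f_def intro!: vec.span_sum vec.span_scale intro: vec.span_base)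
  also have "\<dots> = CARD('n) - vec.dim U"
    using finC C(1) cardC B(3) by (simp add: card_Diff_subset finite_subset)
  finally have "vec.dim U' \<le> CARD('n) - vec.dim U" .
  moreover have "vec.dim U \<le> CARD('n)"
    using B(3) C(1) finC cardC card_mono by metis
  ultimately show ?thesis by linarith
qed

text \<open>
  For the cubic \<open>C x = (\<Sum>i. x\<^sub>i\<^sub>1 x\<^sub>i\<^sub>2 x\<^sub>i\<^sub>3)\<close>, \<open>polar2 w x\<close> is the coefficient of \<open>s\<close> in \<open>C (x + s w)\<close>, a quadratic
  form in \<open>x\<close>; \<open>polar_map w\<close> represents its polar bilinear form.
\<close>

definition polar2 :: "'a::field ^ ('r::finite \<times> 3) \<Rightarrow> 'a ^ ('r \<times> 3) \<Rightarrow> 'a" where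
  "polar2 w x = (\<Sum>i\<in>UNIV. w $ (i,1) * (x $ (i,2) * x $ (i,3)) + w $ (i,2) * (x $ (i,1) * x $ (i,3))
     + w $ (i,3) * (x $ (i,1) * x $ (i,2)))"

definition polar_map :: "'a::field ^ ('r::finite \<times> 3) \<Rightarrow> 'a ^ ('r \<times> 3) \<Rightarrow> 'a ^ ('r \<times> 3)" where
  "polar_map w x = (\<chi> p. case p of (i, j) \<Rightarrow>
     if j = 1 then w $ (i,2) * x $ (i,3) + w $ (i,3) * x $ (i,2)
     else if j = 2 then w $ (i,1) * x $ (i,3) + w $ (i,3) * x $ (i,1)
     else w $ (i,1) * x $ (i,2) + w $ (i,2) * x $ (i,1))"

lemma polar_map_simps [simp]:
  "polar_map w x $ (i,1) = w $ (i,2) * x $ (i,3) + w $ (i,3) * x $ (i,2)"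
  "polar_map w x $ (i,2) = w $ (i,1) * x $ (i,3) + w $ (i,3) * x $ (i,1)"
  "polar_map w x $ (i,3) = w $ (i,1) * x $ (i,2) + w $ (i,2) * x $ (i,1)"
  by (simp_all add: polar_map_def)

lemma sum_UNIV_times_3:
  "(\<Sum>p\<in>UNIV. f p) = (\<Sum>i\<in>UNIV. f (i, 1) + f (i, 2) + f (i, 3::3))"
  by (simp add: sum.cartesian_product' UNIV_Times_UNIV[symmetric] sum_3 del: UNIV_Times_UNIV)

lemma vec_eq_iff_3: "x = y \<longleftrightarrow> (\<forall>i. x $ (i,1) = y $ (i,1) \<and> x $ (i,2) = y $ (i,2) \<and> x $ (i,3::3) = y $ (i,3))"
  by (auto simp: vec_eq_iff forall_3)

lemma polar_map_polar2:
  "(\<Sum>p\<in>UNIV. polar_map w x $ p * y $ p) = polar2 w (x + y) - polar2 w x - polar2 w y"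
  by (simp add: sum_UNIV_times_3 polar2_def sum_subtractf[symmetric] algebra_simps)

lemma linear_polar_map: "Vector_Spaces.linear (*s) (*s) (polar_map w)"
  by (rule vec_linearI) (auto simp: vec_eq_iff_3 algebra_simps)

lemma polar_map_orth:
  fixes W :: "('a::field ^ ('r::finite \<times> 3)) set"
  assumes "vec.subspace W" "\<And>x. x \<in> W \<Longrightarrow> polar2 w x = 0" "x \<in> W" "y \<in> W"
  shows "(\<Sum>p\<in>UNIV. polar_map w x $ p * y $ p) = 0"
  using assms vec.subspace_add[of W x y] by (simp add: polar_map_polar2)

text \<open>On the triple with entries a, b, c of \<open>w\<close>, \<open>polar_map w\<close> is
  the symmetric 3 by 3 matrix with zero diagonal and off-diagonal entries c, b, a. Its determinant
  2abc is nonzero, so \<open>polar_map w\<close> is injective and \<open>W\<close> is orthogonal to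
  an image of its own dimension.\<close>

lemma dim_isotropic_char_not_2:
  fixes W :: "('a::field ^ ('r::finite \<times> 3)) set"
  assumes W: "vec.subspace W" and w: "\<And>p. w $ p \<noteq> 0" and iso: "\<And>x. x \<in> W \<Longrightarrow> polar2 w x = 0"
    and char: "(2::'a) \<noteq> 0"
  shows "2 * vec.dim W \<le> 3 * CARD('r)"
proof -
  interpret B: Vector_Spaces.linear "(*s)" "(*s)" "polar_map w" by (rule linear_polar_map)
  have "x = 0" if "polar_map w x = 0" for x
  proof -
    have "x $ (i,1) = 0 \<and> x $ (i,2) = 0 \<and> x $ (i,3) = 0" for i
    proof -
      let ?a = "w $ (i,1)" and ?b = "w $ (i,2)" and ?c = "w $ (i,3)"
      let ?x = "x $ (i,1)" and ?y = "x $ (i,2)" and ?z = "x $ (i,3)"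
      have e: "?b * ?z + ?c * ?y = 0" "?a * ?z + ?c * ?x = 0" "?a * ?y + ?b * ?x = 0"
        using that by (simp_all add: vec_eq_iff_3)
      have "2 * (?a * ?b * ?z) = 0" using e by algebra
      moreover have "2 * (?a * ?c * ?y) = 0" using e by algebra
      moreover have "2 * (?b * ?c * ?x) = 0" using e by algebra
      ultimately show ?thesis using char w by simp
    qed
    then show ?thesis by (simp add: vec_eq_iff_3)
  qed
  then have inj: "inj_on (polar_map w) W"
    by (subst B.inj_on_iff_eq_0[OF W]) auto
  have "vec.dim (polar_map w ` W) + vec.dim W \<le> CARD('r \<times> 3)"
    by (rule vec_dim_annihilator_le[OF W]) (auto intro: polar_map_orth[OF W iso])
  moreover have "vec.dim (polar_map w ` W) = vec.dim W"
    using vec.dim_image_eq[OF linear_polar_map[of w], of W] inj W by (simp add: vec.span_eq_iff[THEN iffD2])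
  ultimately show ?thesis by simp
qed


section \<open>Isotropic subspaces in characteristic 2\<close>

lemma vec_dim_le_image_kernel:
  fixes f :: "'a::field ^ 'm \<Rightarrow> 'a ^ 'n"
  assumes lin: "Vector_Spaces.linear (*s) (*s) f" and W: "vec.subspace W"
  shows "vec.dim W \<le> vec.dim (f ` W) + vec.dim {x \<in> W. f x = 0}"
proof -
  interpret f: Vector_Spaces.linear "(*s)" "(*s)" f by (rule lin)
  define K where "K = {x \<in> W. f x = 0}"
  obtain D where D: "D \<subseteq> f ` W" "vec.independent D" "f ` W \<subseteq> vec.span D" "card D = vec.dim (f ` W)"
    using vec.basis_exists by metis
  obtain B where B: "B \<subseteq> K" "vec.independent B" "K \<subseteq> vec.span B" "card B = vec.dim K"
    using vec.basis_exists by metis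
  define g where "g = inv_into W f"
  have g: "g d \<in> W \<and> f (g d) = d" if "d \<in> D" for d
    using that D(1) inv_into_into[of d f W] f_inv_into_f[of d f W] by (auto simp: g_def)
  have fin: "finite B" "finite D" using B(2) D(2) vec.finiteI_independent by auto
  have gW: "vec.span (g ` D) \<subseteq> W" using g W by (intro vec.span_minimal) auto
  have "f ` g ` D = D" using g by force
  then have fg: "f ` vec.span (g ` D) = vec.span D" by (metis f.span_image)
  have "W \<subseteq> vec.span (B \<union> g ` D)"
  proof
    fix x assume x: "x \<in> W"
    then have "f x \<in> f ` vec.span (g ` D)" using D(3) fg by auto
    then obtain y where y: "y \<in> vec.span (g ` D)" "f x = f y" by auto
    then have "x - y \<in> K" using x gW W by (auto simp: K_def f.diff intro: vec.subspace_diff)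
    then have "x - y \<in> vec.span (B \<union> g ` D)" using B(3) vec.span_mono[of B "B \<union> g ` D"] by auto
    moreover have "y \<in> vec.span (B \<union> g ` D)" using y vec.span_mono[of "g ` D" "B \<union> g ` D"] by auto
    ultimately have "(x - y) + y \<in> vec.span (B \<union> g ` D)" by (rule vec.span_add)
    then show "x \<in> vec.span (B \<union> g ` D)" by simp
  qed
  then have "vec.dim W \<le> card (B \<union> g ` D)" using fin by (intro vec.dim_le_card) auto
  also have "\<dots> \<le> card B + card (g ` D)" by (rule card_Un_le)
  also have "\<dots> \<le> card B + card D" using fin card_image_le by auto
  finally show ?thesis using B(4) D(4) by (simp add: K_def)
qed

lemma sum_power2_char_2:
  fixes f :: "'b \<Rightarrow> 'a::comm_ring_1"
  assumes "(2::'a) = 0"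
  shows "(\<Sum>x\<in>A. f x)^2 = (\<Sum>x\<in>A. (f x)^2)"
  by (induction A rule: infinite_finite_induct) (simp_all add: power2_sum assms)

text \<open>The twist \<open>q\<close> is additive in characteristic 2 and semilinear for the
  Frobenius map. Since every coefficient has a square root, a linear relation among the
  \<open>q v\<close> is the twist of a relation among the \<open>v\<close>. So \<open>q\<close>
  keeps a basis of \<open>T\<close> independent, and its image is orthogonal to
  \<open>T\<close>.\<close>

lemma dim_power2_orthogonal_char_2:
  fixes T :: "('a::alg_closed_field ^ 'r) set"
  assumes T: "vec.subspace T" and n: "\<And>i. n i \<noteq> 0" and char: "(2::'a) = 0"
    and orth: "\<And>s t. s \<in> T \<Longrightarrow> t \<in> T \<Longrightarrow> (\<Sum>i\<in>UNIV. n i * (t $ i)\<^sup>2 * s $ i) = 0"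
  shows "2 * vec.dim T \<le> CARD('r)"
proof -
  define q where "q t = (\<chi> i. n i * (t $ i)\<^sup>2)" for t :: "'a ^ 'r"
  obtain B where B: "B \<subseteq> T" "vec.independent B" "card B = vec.dim T"
    using vec.basis_exists by metis
  have finB: "finite B" using B(2) by (rule vec.finiteI_independent)
  have inj: "inj_on q B"
  proof
    fix s t assume "q s = q t"
    then have "(s $ i)\<^sup>2 = (t $ i)\<^sup>2" for i using n by (simp add: q_def vec_eq_iff)
    then have "(s $ i - t $ i)\<^sup>2 = 0" for i by (simp add: power2_diff char mult.assoc[symmetric] distrib_right[symmetric] mult_2[symmetric])
    then show "s = t" by (simp add: vec_eq_iff)
  qed
  have "vec.independent (q ` B)"
    unfolding vec.independent_explicit
  proof (intro conjI allI impI ballI)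
    fix c y assume c: "(\<Sum>v\<in>q ` B. c v *s v) = 0" and y: "y \<in> q ` B"
    have "\<forall>v. \<exists>a. a\<^sup>2 = c (q v)" by (simp add: nth_root_exists)
    then obtain d where d: "\<And>v. (d v)\<^sup>2 = c (q v)" by metis
    have 0: "(\<Sum>v\<in>B. c (q v) *s q v) = 0" using c by (simp add: sum.reindex[OF inj])
    have "(\<Sum>v\<in>B. d v *s v) $ i = 0" for i
    proof -
      have "0 = (\<Sum>v\<in>B. c (q v) *s q v) $ i" by (simp add: 0)
      also have "\<dots> = n i * (\<Sum>v\<in>B. (d v * v $ i)\<^sup>2)"
        by (simp add: q_def d power_mult_distrib sum_distrib_left mult_ac)
      also have "\<dots> = n i * ((\<Sum>v\<in>B. d v *s v) $ i)\<^sup>2"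
        by (simp add: sum_power2_char_2[OF char])
      finally show ?thesis using n by simp
    qed
    then have "(\<Sum>v\<in>B. d v *s v) = 0" by (simp add: vec_eq_iff)
    then have "\<forall>v\<in>B. d v = 0" using B(2) unfolding vec.independent_explicit by blast
    moreover obtain v where "v \<in> B" "y = q v" using y by auto
    ultimately show "c y = 0" using d[of v] by simp
  qed (simp add: finB)
  then have "vec.dim (q ` B) = vec.dim T"
    using B(3) card_image[OF inj] vec.dim_eq_card_independent by metis
  moreover have "vec.dim (q ` B) + vec.dim T \<le> CARD('r)"
    by (rule vec_dim_annihilator_le[OF T]) (use B(1) orth in \<open>auto simp: q_def\<close>)
  ultimately show ?thesis by simp
qed

text \<open>
  In characteristic 2 the polar form of \<open>polar2 w\<close> has the radical \<open>{(t\<^sub>i w\<^sub>i\<^sub>j)}\<close>, of dimension \<open>CARD('r)\<close>, so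
  isotropy for it only bounds \<open>dim W\<close> by \<open>CARD('r) + dim T\<close>, with \<open>T\<close> the part of \<open>W\<close> in the radical. The
  condition \<open>polar2 x y = 0\<close> on \<open>T\<close> makes \<open>T\<close> orthogonal to its Frobenius twist, which bounds \<open>dim T\<close>.
\<close>

lemma dim_isotropic_char_2:
  fixes W :: "('a::alg_closed_field ^ ('r::finite \<times> 3)) set"
  assumes W: "vec.subspace W" and w: "\<And>p. w $ p \<noteq> 0" and iso: "\<And>x. x \<in> W \<Longrightarrow> polar2 w x = 0"
    and iso': "\<And>x y. x \<in> W \<Longrightarrow> y \<in> W \<Longrightarrow> polar2 x y = 0"
    and char: "(2::'a) = 0"
  shows "2 * vec.dim W \<le> 3 * CARD('r)"
proof -
  define emb :: "'a ^ 'r \<Rightarrow> 'a ^ ('r \<times> 3)" where "emb t = (\<chi> p. t $ fst p * w $ p)" for t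
  define R where "R = emb ` UNIV"
  define T where "T = {t. emb t \<in> W}"
  have two: "a + a = 0" for a :: 'a using char by (metis mult_2 mult_zero_left)
  have lin: "Vector_Spaces.linear (*s) (*s) emb"
    by (rule vec_linearI) (auto simp: emb_def vec_eq_iff algebra_simps)
  interpret emb: Vector_Spaces.linear "(*s)" "(*s)" emb by (rule lin)
  have inj: "inj emb"
    using w by (auto simp: inj_on_def emb_def vec_eq_iff)
  have dim_emb: "vec.dim (emb ` S) = vec.dim S" for S
    using vec.dim_image_eq[OF lin, of S] inj by (auto intro: inj_on_subset)
  have T: "vec.subspace T"
    unfolding T_def using emb.subspace_vimage[OF W] by (simp add: vimage_def)
  have R: "vec.subspace R" unfolding R_def using emb.subspace_image by auto
  have WR: "W \<inter> R = emb ` T" by (auto simp: R_def T_def)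
  have dimR: "vec.dim R = CARD('r)" unfolding R_def dim_emb by (rule vec_dim_card)
  \<comment> \<open>Without signs, the kernel equations say that each triple of \<open>x\<close> is
    proportional to the triple of \<open>w\<close>; the factor is read off from the first
    coordinate.\<close>
  have ker: "{x \<in> W. polar_map w x = 0} \<subseteq> W \<inter> R"
  proof safe
    fix x assume x: "polar_map w x = 0"
    have "x = emb (\<chi> i. x $ (i,1) / w $ (i,1))"
    proof -
      have "w $ (i,1) * x $ (i,2) = w $ (i,2) * x $ (i,1)" "w $ (i,1) * x $ (i,3) = w $ (i,3) * x $ (i,1)" for i
      proof -
        have "w $ (i,1) * x $ (i,2) + w $ (i,2) * x $ (i,1) = 0" "w $ (i,1) * x $ (i,3) + w $ (i,3) * x $ (i,1) = 0"
          using x by (simp_all add: vec_eq_iff_3)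
        then show "w $ (i,1) * x $ (i,2) = w $ (i,2) * x $ (i,1)" "w $ (i,1) * x $ (i,3) = w $ (i,3) * x $ (i,1)"
          by (metis two add_right_cancel)+
      qed
      then show ?thesis using w by (simp add: vec_eq_iff_3 emb_def field_simps)
    qed
    then show "x \<in> R" by (auto simp: R_def)
  qed
  \<comment> \<open>The image of \<open>W\<close> is orthogonal to \<open>W\<close> by isotropy and
    to the radical \<open>R\<close>, where each product is twice something.\<close>
  have "vec.dim (polar_map w ` W) + vec.dim {x + y |x y. x \<in> W \<and> y \<in> R} \<le> CARD('r \<times> 3)"
  proof (rule vec_dim_annihilator_le)
    fix u v assume "u \<in> polar_map w ` W" "v \<in> {x + y |x y. x \<in> W \<and> y \<in> R}"
    then obtain z x t where z: "z \<in> W" "u = polar_map w z" and x: "x \<in> W" "v = x + emb t"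
      by (auto simp: R_def)
    have "(\<Sum>p\<in>UNIV. polar_map w z $ p * emb t $ p) = (\<Sum>i\<in>(UNIV::'r set). 0)"
      unfolding sum_UNIV_times_3
    proof (rule sum.cong[OF refl])
      fix i
      have "polar_map w z $ (i, 1) * emb t $ (i, 1) + polar_map w z $ (i, 2) * emb t $ (i, 2) +
         polar_map w z $ (i, 3) * emb t $ (i, 3) = 2 * (t $ i * (w $ (i,1) * w $ (i,2) * z $ (i,3)
           + w $ (i,1) * w $ (i,3) * z $ (i,2) + w $ (i,2) * w $ (i,3) * z $ (i,1)))"
        by (simp add: emb_def algebra_simps)
      then show "polar_map w z $ (i, 1) * emb t $ (i, 1) + polar_map w z $ (i, 2) * emb t $ (i, 2) +
         polar_map w z $ (i, 3) * emb t $ (i, 3) = 0" by (simp add: char)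
    qed
    then show "(\<Sum>i\<in>UNIV. u $ i * v $ i) = 0"
      using polar_map_orth[OF W iso z(1) x(1)] z x by (simp add: distrib_left sum.distrib)
  qed (rule vec.subspace_sums[OF W R])
  moreover have "vec.dim {x + y |x y. x \<in> W \<and> y \<in> R} + vec.dim T = vec.dim W + CARD('r)"
    using vec.dim_sums_Int[OF W R] by (simp add: WR dim_emb dimR)
  moreover have "vec.dim W \<le> vec.dim (polar_map w ` W) + vec.dim T"
    using vec_dim_le_image_kernel[OF linear_polar_map[of w] W] vec.dim_subset[OF ker] by (simp add: WR dim_emb)
  moreover have "2 * vec.dim T \<le> CARD('r)"
  proof (rule dim_power2_orthogonal_char_2[OF T _ char])
    show "w $ (i,1) * w $ (i,2) * w $ (i,3) \<noteq> 0" for i using w by simp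
    fix s t assume "s \<in> T" "t \<in> T"
    then have "0 = polar2 (emb s) (emb t)" using iso' by (simp add: T_def)
    \<comment> \<open>On the radical the three terms of \<open>polar2\<close> coincide, and 3 = 1 in
      characteristic 2.\<close>
    also have "\<dots> = (\<Sum>i\<in>UNIV. w $ (i,1) * w $ (i,2) * w $ (i,3) * (t $ i)\<^sup>2 * s $ i)"
      unfolding polar2_def
    proof (rule sum.cong[OF refl])
      fix i
      have "emb s $ (i, 1) * (emb t $ (i, 2) * emb t $ (i, 3)) + emb s $ (i, 2) * (emb t $ (i, 1) * emb t $ (i, 3)) +
        emb s $ (i, 3) * (emb t $ (i, 1) * emb t $ (i, 2)) =
        w $ (i,1) * w $ (i,2) * w $ (i,3) * (t $ i)\<^sup>2 * s $ i + 2 * (w $ (i,1) * w $ (i,2) * w $ (i,3) * (t $ i)\<^sup>2 * s $ i)"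
        by (simp add: emb_def algebra_simps power2_eq_square)
      then show "emb s $ (i, 1) * (emb t $ (i, 2) * emb t $ (i, 3)) + emb s $ (i, 2) * (emb t $ (i, 1) * emb t $ (i, 3)) +
        emb s $ (i, 3) * (emb t $ (i, 1) * emb t $ (i, 2)) = w $ (i,1) * w $ (i,2) * w $ (i,3) * (t $ i)\<^sup>2 * s $ i"
        by (simp add: char)
    qed
    finally show "(\<Sum>i\<in>UNIV. w $ (i,1) * w $ (i,2) * w $ (i,3) * (t $ i)\<^sup>2 * s $ i) = 0" ..
  qed
  \<comment> \<open>With d = dim \<open>W\<close>, e = dim \<open>T\<close>, r =
    \<open>CARD('r)\<close>: the three estimates give (d - e) + (d + r - e) \<le> 3r, and 2e \<le> r
    then yields 2d \<le> 3r.\<close>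
  ultimately show ?thesis by simp
qed

section \<open>Linear subspaces of the cubic\<close>

lemma alg_closed_ex_nonroot:
  fixes p :: "'a::alg_closed_field poly"
  assumes "p \<noteq> 0"
  obtains t where "poly p t \<noteq> 0"
proof -
  \<comment> \<open>A root t of X p - 1 satisfies t p(t) = 1.\<close>
  obtain t where "poly (pCons (-1) p) t = 0"
    using alg_closed_imp_poly_has_root[of "pCons (-1) p"] assms by auto
  then show ?thesis by (intro that[of t]) auto
qed

text \<open>Expand the cubic at x + s y: the middle terms s \<open>polar2 y x\<close> + s^2
  \<open>polar2 x y\<close> vanish for every scalar s. Two values of s, namely 1 and one other than
  0 and 1, separate the terms.\<close>

lemma polar2_eq_0_of_cubic:
  fixes W :: "('a::alg_closed_field ^ ('r::finite \<times> 3)) set"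
  assumes W: "vec.subspace W"
    and cub: "\<And>x. x \<in> W \<Longrightarrow> (\<Sum>i\<in>UNIV. x $ (i,1) * x $ (i,2) * x $ (i,3)) = 0"
    and x: "x \<in> W" and y: "y \<in> W"
  shows "polar2 x y = 0"
proof -
  have *: "s * polar2 y x + s\<^sup>2 * polar2 x y = 0" for s
  proof -
    have "x + s *s y \<in> W" using W x y by (simp add: vec.subspace_add vec.subspace_scale)
    then have "0 = (\<Sum>i\<in>UNIV. (x + s *s y) $ (i,1) * (x + s *s y) $ (i,2) * (x + s *s y) $ (i,3))"
      by (rule cub[symmetric])
    also have "\<dots> = (\<Sum>i\<in>UNIV. x $ (i,1) * x $ (i,2) * x $ (i,3)) + s * polar2 y x + s\<^sup>2 * polar2 x y
        + s^3 * (\<Sum>i\<in>UNIV. y $ (i,1) * y $ (i,2) * y $ (i,3))"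
      by (simp add: polar2_def sum_distrib_left sum.distrib[symmetric] power2_eq_square power3_eq_cube algebra_simps)
    finally show ?thesis by (simp add: cub x y)
  qed
  \<comment> \<open>This choice guarantees that s differs from 0 and 1 in every
    characteristic.\<close>
  obtain s :: 'a where s: "s * (s - 1) = 1"
    using alg_closed_imp_poly_has_root[of "[:-1, -1, 1::'a:]"] by (auto simp: algebra_simps)
  have "polar2 y x = - polar2 x y" using *[of 1] by (simp add: eq_neg_iff_add_eq_0)
  then have "s * (s - 1) * polar2 x y = 0" using *[of s] by (simp add: algebra_simps power2_eq_square)
  then show ?thesis by (simp add: s)
qed

text \<open>
  A zero coordinate of \<open>x0\<close> forces the whole triple of every \<open>x \<in> W\<close> to vanish, so it may be replaced by \<open>1\<close>
  without affecting \<open>polar2 x0\<close> on \<open>W\<close>.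
\<close>

lemma dim_cubic_subspace:
  fixes W :: "('a::alg_closed_field ^ ('r::finite \<times> 3)) set"
  assumes W: "vec.subspace W"
    and cub: "\<And>x. x \<in> W \<Longrightarrow> (\<Sum>i\<in>UNIV. x $ (i,1) * x $ (i,2) * x $ (i,3)) = 0"
    and x0: "x0 \<in> W"
    and bad: "\<And>x i j k. x0 $ (i,j) = 0 \<Longrightarrow> x \<in> W \<Longrightarrow> x $ (i,k) = 0"
  shows "2 * vec.dim W \<le> 3 * CARD('r)"
proof -
  define w where "w = (\<chi> p. if x0 $ p = 0 then 1 else x0 $ p)"
  have w: "w $ p \<noteq> 0" for p by (simp add: w_def)
  have iso: "polar2 w x = 0" if x: "x \<in> W" for x
  proof -
    have "polar2 w x = polar2 x0 x"
      unfolding polar2_def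
    proof (rule sum.cong[OF refl])
      fix i :: 'r
      show "w $ (i,1) * (x $ (i,2) * x $ (i,3)) + w $ (i,2) * (x $ (i,1) * x $ (i,3)) + w $ (i,3) * (x $ (i,1) * x $ (i,2))
        = x0 $ (i,1) * (x $ (i,2) * x $ (i,3)) + x0 $ (i,2) * (x $ (i,1) * x $ (i,3)) + x0 $ (i,3) * (x $ (i,1) * x $ (i,2))"
        using bad[OF _ x, of i] by (cases "\<exists>j. x0 $ (i,j) = 0") (auto simp: w_def)
    qed
    then show ?thesis using polar2_eq_0_of_cubic[OF W cub x0 x] by simp
  qed
  show ?thesis
  proof (cases "(2::'a) = 0")
    case True
    show ?thesis using dim_isotropic_char_2[OF W w iso polar2_eq_0_of_cubic[OF W cub] True] by blast
  next
    case False
    show ?thesis using dim_isotropic_char_not_2[OF W w iso False] by blast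
  qed
qed

subsection \<open>Evaluation of polynomials\<close>

definition eval_monom :: "('v \<Rightarrow> 'a::comm_ring_1) \<Rightarrow> ('v \<Rightarrow>\<^sub>0 nat) \<Rightarrow> 'a" where
  "eval_monom \<rho> m = (\<Prod>v\<in>Poly_Mapping.keys m. \<rho> v ^ Poly_Mapping.lookup m v)"

definition eval_mpoly :: "('v \<Rightarrow> 'a::comm_ring_1) \<Rightarrow> ('v, 'a) mpoly \<Rightarrow> 'a" where
  "eval_mpoly \<rho> p = (\<Sum>m\<in>Poly_Mapping.keys p. Poly_Mapping.lookup p m * eval_monom \<rho> m)"

lemma eval_monom_superset:
  assumes "finite A" "Poly_Mapping.keys m \<subseteq> A"
  shows "eval_monom \<rho> m = (\<Prod>v\<in>A. \<rho> v ^ Poly_Mapping.lookup m v)"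
  unfolding eval_monom_def
  by (rule prod.mono_neutral_left) (use assms in \<open>auto simp: in_keys_iff\<close>)

lemma eval_monom_add: "eval_monom \<rho> (m + n) = eval_monom \<rho> m * eval_monom \<rho> n"
proof -
  let ?A = "Poly_Mapping.keys m \<union> Poly_Mapping.keys n"
  have "eval_monom \<rho> (m + n) = (\<Prod>v\<in>?A. \<rho> v ^ Poly_Mapping.lookup (m + n) v)"
    by (rule eval_monom_superset) (auto simp: Poly_Mapping.keys_add)
  also have "\<dots> = eval_monom \<rho> m * eval_monom \<rho> n"
    by (simp add: eval_monom_superset[of ?A] lookup_add power_add prod.distrib)
  finally show ?thesis .
qed

lemma eval_mpoly_superset:
  assumes "finite A" "Poly_Mapping.keys p \<subseteq> A"
  shows "eval_mpoly \<rho> p = (\<Sum>m\<in>A. Poly_Mapping.lookup p m * eval_monom \<rho> m)"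
  unfolding eval_mpoly_def
  by (rule sum.mono_neutral_left) (use assms in \<open>auto simp: in_keys_iff\<close>)

lemma eval_mpoly_0 [simp]: "eval_mpoly \<rho> 0 = 0"
  by (simp add: eval_mpoly_def)

lemma eval_mpoly_add: "eval_mpoly \<rho> (p + q) = eval_mpoly \<rho> p + eval_mpoly \<rho> q"
proof -
  let ?A = "Poly_Mapping.keys p \<union> Poly_Mapping.keys q"
  have "eval_mpoly \<rho> (p + q) = (\<Sum>m\<in>?A. Poly_Mapping.lookup (p + q) m * eval_monom \<rho> m)"
    by (rule eval_mpoly_superset) (auto simp: Poly_Mapping.keys_add)
  also have "\<dots> = eval_mpoly \<rho> p + eval_mpoly \<rho> q"
    by (simp add: eval_mpoly_superset[of ?A] lookup_add distrib_right sum.distrib)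
  finally show ?thesis .
qed

lemma eval_mpoly_single: "eval_mpoly \<rho> (Poly_Mapping.single m c) = c * eval_monom \<rho> m"
  by (simp add: eval_mpoly_def)

lemma eval_mpoly_sum: "eval_mpoly \<rho> (sum f A) = (\<Sum>x\<in>A. eval_mpoly \<rho> (f x))"
  by (induction A rule: infinite_finite_induct) (simp_all add: eval_mpoly_add)

lemma eval_mpoly_uminus: "eval_mpoly \<rho> (- p) = - eval_mpoly \<rho> p"
  using eval_mpoly_add[of \<rho> "- p" p] by (simp add: eq_neg_iff_add_eq_0)

lemma mpoly_eq_sum_single:
  "p = (\<Sum>m\<in>Poly_Mapping.keys p. Poly_Mapping.single m (Poly_Mapping.lookup p m))"
  by (rule poly_mapping_eqI)
     (auto simp: lookup_sum lookup_single when_def in_keys_iff sum.delta)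

lemma eval_mpoly_mult: "eval_mpoly \<rho> (p * q) = eval_mpoly \<rho> p * eval_mpoly \<rho> q"
proof -
  let ?s = "\<lambda>p. \<lambda>m. Poly_Mapping.single m (Poly_Mapping.lookup p m)"
  have "eval_mpoly \<rho> (p * q) =
      eval_mpoly \<rho> ((\<Sum>m\<in>Poly_Mapping.keys p. ?s p m) * (\<Sum>n\<in>Poly_Mapping.keys q. ?s q n))"
    by (simp add: mpoly_eq_sum_single[symmetric])
  also have "\<dots> = eval_mpoly \<rho> p * eval_mpoly \<rho> q"
    unfolding sum_product eval_mpoly_sum mult_single eval_mpoly_single eval_monom_add
    by (simp add: eval_mpoly_def sum_product mult_ac)
  finally show ?thesis .
qed

lemma eval_monom_0 [simp]: "eval_monom \<rho> 0 = 1"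
  by (simp add: eval_monom_def)

lemma eval_mpoly_of_int [simp]: "eval_mpoly \<rho> (of_int k) = of_int k"
  by (metis eval_mpoly_single eval_monom_0 mult.right_neutral single_of_int)

lemma eval_mpoly_1 [simp]: "eval_mpoly \<rho> 1 = 1"
  using eval_mpoly_of_int[of \<rho> 1] by simp

lemma eval_mpoly_prod: "eval_mpoly \<rho> (prod f A) = (\<Prod>x\<in>A. eval_mpoly \<rho> (f x))"
  by (induction A rule: infinite_finite_induct) (simp_all add: eval_mpoly_mult)

lemma eval_mpoly_Const [simp]: "eval_mpoly \<rho> (Const c) = c"
  by (simp add: Const_def eval_mpoly_single)

lemma eval_mpoly_Var [simp]: "eval_mpoly \<rho> (Var v) = \<rho> v"
  by (simp add: Var_def eval_mpoly_single eval_monom_def)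

lemma eval_mpoly_pfaffian:
  "eval_mpoly \<rho> (pfaffian n A) = pfaffian n (\<lambda>i j. eval_mpoly \<rho> (A i j))"
  by (simp add: pfaffian_def eval_mpoly_sum eval_mpoly_mult eval_mpoly_prod)

lemma eval_mpoly_generic_skew:
  "eval_mpoly \<rho> (generic_skew i j) = (if i < j then \<rho> (i, j) else if j < i then - \<rho> (j, i) else 0)"
  by (simp add: generic_skew_def eval_mpoly_uminus)

subsection \<open>The Pfaffian of size 6\<close>

definition perm_of_list :: "nat list \<Rightarrow> nat \<Rightarrow> nat" where
  "perm_of_list xs i = (if i < length xs then xs ! i else i)"

definition matchings6 :: "nat list list" where
  "matchings6 =
    [[0,1,2,3,4,5], [0,1,2,4,3,5], [0,1,2,5,3,4],
     [0,2,1,3,4,5], [0,2,1,4,3,5], [0,2,1,5,3,4],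
     [0,3,1,2,4,5], [0,3,1,4,2,5], [0,3,1,5,2,4],
     [0,4,1,2,3,5], [0,4,1,3,2,5], [0,4,1,5,2,3],
     [0,5,1,2,3,4], [0,5,1,3,2,4], [0,5,1,4,2,3]]"

lemma lessThan_6: "{..<6::nat} = {0,1,2,3,4,5}" by auto

text \<open>The ranges are what the ordering of a matching leaves: \<open>b\<close> lies below
  \<open>c\<close>, \<open>d\<close>, \<open>e\<close>, hence is at most 2, and \<open>d < e\<close>
  keeps \<open>d\<close> at most 4. The conditions are nested so that impossible cases drop out
  early.\<close>

lemma mem_matchings6I [rule_format]:
  "\<forall>a\<in>{1,2,3,4,5}. \<forall>b\<in>{1,2}. a \<noteq> b \<longrightarrow>
    (\<forall>c\<in>{2,3,4,5}. b < c \<longrightarrow> a \<noteq> c \<longrightarrow>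
    (\<forall>d\<in>{2,3,4}. b < d \<longrightarrow> a \<noteq> d \<longrightarrow> c \<noteq> d \<longrightarrow>
    (\<forall>e\<in>{3,4,5}. d < e \<longrightarrow> a \<noteq> e \<longrightarrow> c \<noteq> e \<longrightarrow> [0,a,b,c,d,e] \<in> set matchings6)))"
  unfolding matchings6_def by simp

lemma matching_perms_3: "matching_perms 3 = perm_of_list ` set matchings6"
proof (intro subset_antisym subsetI)
  fix p assume "p \<in> matching_perms 3"
  then have perm: "p permutes {..<6}"
    and lt: "\<And>i. i < 3 \<Longrightarrow> p (2*i) < p (2*i + 1)"
    and lt': "\<And>i j. i < j \<Longrightarrow> j < 3 \<Longrightarrow> p (2*i) < p (2*j)"
    by (auto simp: matching_perms_def)
  have ord: "p 0 < p 1" "p 2 < p 3" "p 4 < p 5" "p 0 < p 2" "p 2 < p 4"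
    using lt[of 0] lt[of 1] lt[of 2] lt'[of 0 1] lt'[of 1 2] by simp_all
  have inj: "inj p" using perm by (rule permutes_inj)
  have img: "p ` {..<6} = {..<6}" using perm by (rule permutes_image)
  have ne: "p 1 \<noteq> p 2" "p 1 \<noteq> p 3" "p 1 \<noteq> p 4" "p 1 \<noteq> p 5" "p 3 \<noteq> p 4" "p 3 \<noteq> p 5"
    using inj by (simp_all add: inj_eq)
  have bound: "p i < 6" if "i < 6" for i
    using img that by (metis image_eqI lessThan_iff)
  define xs where "xs = map p [0..<6]"
  have xs: "xs = [p 0, p 1, p 2, p 3, p 4, p 5]"
    by (simp add: xs_def upt_rec numeral_eq_Suc)
  have p: "p = perm_of_list xs"
    using perm by (auto simp: perm_of_list_def xs_def permutes_def)
  have "p 0 = 0"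
  proof -
    have "0 \<in> p ` {..<6}" using img by simp
    then show ?thesis using ord by (auto simp: lessThan_6)
  qed
  moreover have "p 1 \<in> {1..5}" "p 2 \<in> {1..2}" "p 3 \<in> {2..5}" "p 4 \<in> {2..4}" "p 5 \<in> {3..5}"
    using ord ne bound[of 1] bound[of 3] bound[of 5] calculation by auto
  moreover have "{1..5} = {1,2,3,4,5::nat}" "{1..2} = {1,2::nat}" "{2..5} = {2,3,4,5::nat}"
      "{2..4} = {2,3,4::nat}" "{3..5} = {3,4,5::nat}"
    by auto
  ultimately have "p 1 \<in> {1,2,3,4,5}" "p 2 \<in> {1,2}" "p 3 \<in> {2,3,4,5}" "p 4 \<in> {2,3,4}" "p 5 \<in> {3,4,5}"
    by (simp_all del: One_nat_def atLeastAtMost_iff)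
  then have "xs \<in> set matchings6"
    unfolding xs \<open>p 0 = 0\<close> using ord ne by (intro mem_matchings6I) simp_all
  then show "p \<in> perm_of_list ` set matchings6" using p by blast
next
  fix p assume "p \<in> perm_of_list ` set matchings6"
  then obtain xs where xs: "xs \<in> set matchings6" and p: "p = perm_of_list xs" by auto
  have len: "length xs = 6" and dist: "distinct xs" and set: "set xs = {..<6}"
    using xs by (auto simp: matchings6_def lessThan_6)
  have "p permutes {..<6}"
  proof (rule bij_imp_permutes)
    have "bij_betw ((!) xs) {..<length xs} (set xs)"
      by (rule bij_betw_nth[OF dist]) simp_all
    then have "bij_betw ((!) xs) {..<6} {..<6}" using set len by simp
    also have "?this \<longleftrightarrow> bij_betw p {..<6} {..<6}"
      by (rule bij_betw_cong) (simp add: p perm_of_list_def len)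
    finally show "bij_betw p {..<6} {..<6}" .
  qed (simp add: p perm_of_list_def len)
  moreover have "\<forall>i<3. p (2*i) < p (2*i + 1)"
    using xs by (auto simp: p perm_of_list_def matchings6_def numeral_3_eq_3 less_Suc_eq)
  moreover have "\<forall>i j. i < j \<and> j < 3 \<longrightarrow> p (2*i) < p (2*j)"
    using xs by (auto simp: p perm_of_list_def matchings6_def numeral_3_eq_3 less_Suc_eq)
  ultimately show "p \<in> matching_perms 3"
    by (simp add: matching_perms_def)
qed

lemma inj_perm_of_list: "inj_on perm_of_list {xs. length xs = n}"
proof
  fix xs ys :: "nat list"
  assume len: "xs \<in> {xs. length xs = n}" "ys \<in> {xs. length xs = n}" and eq: "perm_of_list xs = perm_of_list ys"
  show "xs = ys"
  proof (rule nth_equalityI)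
    fix i assume "i < length xs"
    then show "xs ! i = ys ! i" using fun_cong[OF eq, of i] len by (simp add: perm_of_list_def)
  qed (use len in simp)
qed

text \<open>Each permutation is given explicitly as a product of transpositions, and the parity of
  their number gives the sign.\<close>

lemma sign_perm_of_list:
  "sign (perm_of_list [0,1,2,3,4,5]) = 1"
  "sign (perm_of_list [0,1,2,4,3,5]) = -1"
  "sign (perm_of_list [0,1,2,5,3,4]) = 1"
  "sign (perm_of_list [0,2,1,3,4,5]) = -1"
  "sign (perm_of_list [0,2,1,4,3,5]) = 1"
  "sign (perm_of_list [0,2,1,5,3,4]) = -1"
  "sign (perm_of_list [0,3,1,2,4,5]) = 1"
  "sign (perm_of_list [0,3,1,4,2,5]) = -1"
  "sign (perm_of_list [0,3,1,5,2,4]) = 1"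
  "sign (perm_of_list [0,4,1,2,3,5]) = -1"
  "sign (perm_of_list [0,4,1,3,2,5]) = 1"
  "sign (perm_of_list [0,4,1,5,2,3]) = -1"
  "sign (perm_of_list [0,5,1,2,3,4]) = 1"
  "sign (perm_of_list [0,5,1,3,2,4]) = -1"
  "sign (perm_of_list [0,5,1,4,2,3]) = 1"
proof -
  have *: "sign p = (if even (length ts) then 1 else - 1)"
    if "p = apply_transps ts" "\<forall>(a,b)\<in>set ts. a \<noteq> b" for p :: "nat \<Rightarrow> nat" and ts
    using that by (simp add: sign_def evenperm_apply_transps_iff case_prod_beta)
  show "sign (perm_of_list [0,1,2,3,4,5]) = 1"
    by (subst *[of _ "[]"]) (auto simp: fun_eq_iff perm_of_list_def Transposition.transpose_def nth_Cons' apply_transps_def)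
  show "sign (perm_of_list [0,1,2,4,3,5]) = -1"
    by (subst *[of _ "[(3,4)]"]) (auto simp: fun_eq_iff perm_of_list_def Transposition.transpose_def nth_Cons' apply_transps_def)
  show "sign (perm_of_list [0,1,2,5,3,4]) = 1"
    by (subst *[of _ "[(3,5),(4,5)]"]) (auto simp: fun_eq_iff perm_of_list_def Transposition.transpose_def nth_Cons' apply_transps_def)
  show "sign (perm_of_list [0,2,1,3,4,5]) = -1"
    by (subst *[of _ "[(1,2)]"]) (auto simp: fun_eq_iff perm_of_list_def Transposition.transpose_def nth_Cons' apply_transps_def)
  show "sign (perm_of_list [0,2,1,4,3,5]) = 1"
    by (subst *[of _ "[(1,2),(3,4)]"]) (auto simp: fun_eq_iff perm_of_list_def Transposition.transpose_def nth_Cons' apply_transps_def)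
  show "sign (perm_of_list [0,2,1,5,3,4]) = -1"
    by (subst *[of _ "[(1,2),(3,5),(4,5)]"]) (auto simp: fun_eq_iff perm_of_list_def Transposition.transpose_def nth_Cons' apply_transps_def)
  show "sign (perm_of_list [0,3,1,2,4,5]) = 1"
    by (subst *[of _ "[(1,3),(2,3)]"]) (auto simp: fun_eq_iff perm_of_list_def Transposition.transpose_def nth_Cons' apply_transps_def)
  show "sign (perm_of_list [0,3,1,4,2,5]) = -1"
    by (subst *[of _ "[(1,3),(2,3),(3,4)]"]) (auto simp: fun_eq_iff perm_of_list_def Transposition.transpose_def nth_Cons' apply_transps_def)
  show "sign (perm_of_list [0,3,1,5,2,4]) = 1"
    by (subst *[of _ "[(1,3),(2,3),(3,5),(4,5)]"]) (auto simp: fun_eq_iff perm_of_list_def Transposition.transpose_def nth_Cons' apply_transps_def)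
  show "sign (perm_of_list [0,4,1,2,3,5]) = -1"
    by (subst *[of _ "[(1,4),(2,4),(3,4)]"]) (auto simp: fun_eq_iff perm_of_list_def Transposition.transpose_def nth_Cons' apply_transps_def)
  show "sign (perm_of_list [0,4,1,3,2,5]) = 1"
    by (subst *[of _ "[(1,4),(2,4)]"]) (auto simp: fun_eq_iff perm_of_list_def Transposition.transpose_def nth_Cons' apply_transps_def)
  show "sign (perm_of_list [0,4,1,5,2,3]) = -1"
    by (subst *[of _ "[(1,4),(2,4),(3,5)]"]) (auto simp: fun_eq_iff perm_of_list_def Transposition.transpose_def nth_Cons' apply_transps_def)
  show "sign (perm_of_list [0,5,1,2,3,4]) = 1"
    by (subst *[of _ "[(1,5),(2,5),(3,5),(4,5)]"]) (auto simp: fun_eq_iff perm_of_list_def Transposition.transpose_def nth_Cons' apply_transps_def)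
  show "sign (perm_of_list [0,5,1,3,2,4]) = -1"
    by (subst *[of _ "[(1,5),(2,5),(4,5)]"]) (auto simp: fun_eq_iff perm_of_list_def Transposition.transpose_def nth_Cons' apply_transps_def)
  show "sign (perm_of_list [0,5,1,4,2,3]) = 1"
    by (subst *[of _ "[(1,5),(2,5),(3,4),(4,5)]"]) (auto simp: fun_eq_iff perm_of_list_def Transposition.transpose_def nth_Cons' apply_transps_def)
qed

lemma pfaffian_3:
  "pfaffian 3 A =
     A 0 1 * A 2 3 * A 4 5 - A 0 1 * A 2 4 * A 3 5 + A 0 1 * A 2 5 * A 3 4
   - A 0 2 * A 1 3 * A 4 5 + A 0 2 * A 1 4 * A 3 5 - A 0 2 * A 1 5 * A 3 4
   + A 0 3 * A 1 2 * A 4 5 - A 0 3 * A 1 4 * A 2 5 + A 0 3 * A 1 5 * A 2 4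
   - A 0 4 * A 1 2 * A 3 5 + A 0 4 * A 1 3 * A 2 5 - A 0 4 * A 1 5 * A 2 3
   + A 0 5 * A 1 2 * A 3 4 - A 0 5 * A 1 3 * A 2 4 + A 0 5 * A 1 4 * A 2 3"
proof -
  have len: "length xs = 6" if "xs \<in> set matchings6" for xs
    using that by (auto simp: matchings6_def)
  have prod3: "(\<Prod>i<3. f i) = f 0 * f 1 * f (2::nat)" for f :: "nat \<Rightarrow> 'a"
    by (simp add: numeral_3_eq_3 numeral_2_eq_2)
  have "pfaffian 3 A = (\<Sum>xs\<in>set matchings6. of_int (sign (perm_of_list xs)) *
          (A (xs ! 0) (xs ! 1) * A (xs ! 2) (xs ! 3) * A (xs ! 4) (xs ! 5)))"
    unfolding pfaffian_def matching_perms_3 prod3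
    by (subst sum.reindex)
       (auto intro: inj_on_subset[OF inj_perm_of_list[of 6]] simp: len perm_of_list_def intro!: sum.cong)
  also have "\<dots> = (\<Sum>xs\<leftarrow>matchings6. of_int (sign (perm_of_list xs)) *
          (A (xs ! 0) (xs ! 1) * A (xs ! 2) (xs ! 3) * A (xs ! 4) (xs ! 5)))"
    by (subst sum_list_distinct_conv_sum_set) (simp_all add: matchings6_def)
  finally show ?thesis
    by (simp add: matchings6_def sign_perm_of_list algebra_simps del: One_nat_def)
qed

section \<open>Singular skew matrices and linear forms on them\<close>

definition pf6 :: "(nat \<times> nat \<Rightarrow> 'a::comm_ring_1) \<Rightarrow> 'a" where
  "pf6 \<rho> =
     \<rho> (0,1) * \<rho> (2,3) * \<rho> (4,5) - \<rho> (0,1) * \<rho> (2,4) * \<rho> (3,5) + \<rho> (0,1) * \<rho> (2,5) * \<rho> (3,4)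
   - \<rho> (0,2) * \<rho> (1,3) * \<rho> (4,5) + \<rho> (0,2) * \<rho> (1,4) * \<rho> (3,5) - \<rho> (0,2) * \<rho> (1,5) * \<rho> (3,4)
   + \<rho> (0,3) * \<rho> (1,2) * \<rho> (4,5) - \<rho> (0,3) * \<rho> (1,4) * \<rho> (2,5) + \<rho> (0,3) * \<rho> (1,5) * \<rho> (2,4)
   - \<rho> (0,4) * \<rho> (1,2) * \<rho> (3,5) + \<rho> (0,4) * \<rho> (1,3) * \<rho> (2,5) - \<rho> (0,4) * \<rho> (1,5) * \<rho> (2,3)
   + \<rho> (0,5) * \<rho> (1,2) * \<rho> (3,4) - \<rho> (0,5) * \<rho> (1,3) * \<rho> (2,4) + \<rho> (0,5) * \<rho> (1,4) * \<rho> (2,3)"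

lemma eval_pfaffian_3: "eval_mpoly \<rho> (pfaffian 3 generic_skew) = pf6 \<rho>"
  unfolding eval_mpoly_pfaffian unfolding pfaffian_3 eval_mpoly_generic_skew pf6_def by simp

text \<open>
  The unique skew matrix with entries \<open>a (i, j)\<close> for \<open>1 \<le> i < j \<le> 5\<close> whose kernel contains \<open>(1, x 1, \<dots>, x 5)\<close>.
\<close>

definition skew_ext :: "(nat \<Rightarrow> 'a::comm_ring_1) \<Rightarrow> (nat \<times> nat \<Rightarrow> 'a) \<Rightarrow> nat \<times> nat \<Rightarrow> 'a" where
  "skew_ext x a = (\<lambda>(i, j). if i = 0 then (\<Sum>k\<in>{j<..<6}. a (j, k) * x k) - (\<Sum>k\<in>{1..<j}. a (k, j) * x k)
     else a (i, j))"

lemma skew_ext_simps: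
  "i \<noteq> 0 \<Longrightarrow> skew_ext x a (i, j) = a (i, j)"
  "skew_ext x a (0, 1) = a (1,2) * x 2 + a (1,3) * x 3 + a (1,4) * x 4 + a (1,5) * x 5"
  "skew_ext x a (0, 2) = a (2,3) * x 3 + a (2,4) * x 4 + a (2,5) * x 5 - a (1,2) * x 1"
  "skew_ext x a (0, 3) = a (3,4) * x 4 + a (3,5) * x 5 - a (1,3) * x 1 - a (2,3) * x 2"
  "skew_ext x a (0, 4) = a (4,5) * x 5 - a (1,4) * x 1 - a (2,4) * x 2 - a (3,4) * x 3"
  "skew_ext x a (0, 5) = - a (1,5) * x 1 - a (2,5) * x 2 - a (3,5) * x 3 - a (4,5) * x 4"
proof -
  have sets: "{1<..<6} = {2,3,4,5::nat}" "{2<..<6} = {3,4,5::nat}" "{3<..<6} = {4,5::nat}" "{4<..<6} = {5::nat}" "{5<..<6} = ({}::nat set)"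
    "{1..<1} = ({}::nat set)" "{1..<2} = {1::nat}" "{1..<3} = {1,2::nat}" "{1..<4} = {1,2,3::nat}" "{1..<5} = {1,2,3,4::nat}"
    by auto
  show "skew_ext x a (0, 1) = a (1,2) * x 2 + a (1,3) * x 3 + a (1,4) * x 4 + a (1,5) * x 5"
    "skew_ext x a (0, 2) = a (2,3) * x 3 + a (2,4) * x 4 + a (2,5) * x 5 - a (1,2) * x 1"
    "skew_ext x a (0, 3) = a (3,4) * x 4 + a (3,5) * x 5 - a (1,3) * x 1 - a (2,3) * x 2"
    "skew_ext x a (0, 4) = a (4,5) * x 5 - a (1,4) * x 1 - a (2,4) * x 2 - a (3,4) * x 3"
    "skew_ext x a (0, 5) = - a (1,5) * x 1 - a (2,5) * x 2 - a (3,5) * x 3 - a (4,5) * x 4"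
    unfolding skew_ext_def prod.case sets by simp_all
qed (simp add: skew_ext_def)

lemma skew_ext_add: "skew_ext x (\<lambda>v. a v + b v) = (\<lambda>v. skew_ext x a v + skew_ext x b v)"
  by (simp add: skew_ext_def fun_eq_iff distrib_right sum.distrib)

lemma skew_ext_scale: "skew_ext x (\<lambda>v. c * a v) = (\<lambda>v. c * skew_ext x a v)"
  by (simp add: skew_ext_def fun_eq_iff sum_distrib_left right_diff_distrib mult.assoc)

text \<open>The matrix kills \<open>(1, x 1, ..., x 5)\<close>, so one expects its Pfaffian to
  vanish; expanding confirms this as an identity over any commutative ring.\<close>

lemma pf6_skew_ext: "pf6 (skew_ext x a) = 0"
  by (simp add: pf6_def skew_ext_simps algebra_simps del: One_nat_def)

lemma upper_entries_6:
  "upper_entries 6 = {(0,1),(0,2),(0,3),(0,4),(0,5),(1,2),(1,3),(1,4),(1,5),(2,3),(2,4),(2,5),(3,4),(3,5),(4,5)}"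
proof -
  have "upper_entries 6 = (\<Union>j\<in>{..<6}. (\<lambda>i. (i, j)) ` {..<j})"
    by (auto simp: upper_entries_def)
  also have "\<dots> = (\<Union>j\<in>{0,1,2,3,4,5}. (\<lambda>i. (i, j)) ` {..<j})"
    by (simp only: lessThan_6)
  also have "\<dots> = {(0,1),(0,2),(0,3),(0,4),(0,5),(1,2),(1,3),(1,4),(1,5),(2,3),(2,4),(2,5),(3,4),(3,5),(4,5)}"
    by (simp add: numeral_eq_Suc lessThan_Suc insert_commute)
  finally show ?thesis .
qed

text \<open>The Pfaffian is constant along no direction with a nonzero entry outside row 0. This
  will make the linear forms of a decomposition separate the matrices
  \<open>skew_ext x a\<close>.\<close>

lemma pf6_concise:
  fixes \<rho> :: "nat \<times> nat \<Rightarrow> 'a::comm_ring_1"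
  assumes "\<And>\<sigma>. pf6 (\<lambda>v. \<rho> v + \<sigma> v) = pf6 \<sigma>" and ij: "(i, j) \<in> upper_entries 6" "i \<noteq> 0"
  shows "\<rho> (i, j) = 0"
proof -
  define e :: "(nat \<times> nat) set \<Rightarrow> nat \<times> nat \<Rightarrow> 'a" where "e S v = (if v \<in> S then 1 else 0)" for S v
  \<comment> \<open>a second difference; it isolates the entry matched with \<open>u\<close> and \<open>u'\<close>\<close>
  define D where "D u u' = pf6 (\<lambda>v. \<rho> v + e {u, u'} v) - pf6 (\<lambda>v. \<rho> v + e {u} v)
      - pf6 (\<lambda>v. \<rho> v + e {u'} v) + pf6 (\<lambda>v. \<rho> v + e {} v)" for u u'
  have D0: "D (0,k) (l,m) = 0" for k l m
    unfolding D_def assms(1) by (simp add: pf6_def e_def)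
  \<comment> \<open>Each pair is completed by the entry on the right to a matching of positive
    sign.\<close>
  have "D (0,3) (4,5) = \<rho> (1,2)" "D (0,4) (2,5) = \<rho> (1,3)" "D (0,2) (3,5) = \<rho> (1,4)"
    "D (0,3) (2,4) = \<rho> (1,5)" "D (0,1) (4,5) = \<rho> (2,3)" "D (0,3) (1,5) = \<rho> (2,4)"
    "D (0,1) (3,4) = \<rho> (2,5)" "D (0,1) (2,5) = \<rho> (3,4)" "D (0,2) (1,4) = \<rho> (3,5)" "D (0,1) (2,3) = \<rho> (4,5)"
    by (simp_all add: D_def pf6_def e_def algebra_simps del: One_nat_def)
  then have "\<rho> (1,2) = 0" "\<rho> (1,3) = 0" "\<rho> (1,4) = 0" "\<rho> (1,5) = 0" "\<rho> (2,3) = 0"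
    "\<rho> (2,4) = 0" "\<rho> (2,5) = 0" "\<rho> (3,4) = 0" "\<rho> (3,5) = 0" "\<rho> (4,5) = 0"
    unfolding D0 by simp_all
  then show ?thesis using ij unfolding upper_entries_6 by auto
qed

text \<open>
  The form with coefficients \<open>c\<close>, evaluated along a curve in the variety of singular matrices. The exponents
  \<open>36 i + 6 j + k\<close> with \<open>k \<le> 5\<close> are distinct, so each \<open>c v\<close> can be read off as a coefficient.
\<close>

definition form_poly :: "(nat \<times> nat \<Rightarrow> 'a::comm_ring_1) \<Rightarrow> 'a poly" where
  "form_poly c = (\<Sum>v\<in>upper_entries 6. smult (c v) (skew_ext (monom 1) (\<lambda>(i, j). monom 1 (36 * i + 6 * j)) v))"

lemma poly_form_poly:
  "poly (form_poly c) t = (\<Sum>v\<in>upper_entries 6. c v * skew_ext (\<lambda>k. t ^ k) (\<lambda>(i, j). t ^ (36 * i + 6 * j)) v)"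
  unfolding form_poly_def poly_sum poly_smult
  by (intro sum.cong refl) (auto simp: skew_ext_def poly_sum poly_monom)

text \<open>Modulo 6 an exponent is 0 for entries outside row 0, and otherwise the index
  \<open>k\<close> of the factor \<open>x k\<close>. Thus \<open>c (0, j)\<close> for
  \<open>j\<close> > 1 is read off from the term \<open>a (1, j) * x 1\<close>, at 36 + 6j + 1, and
  \<open>c (0, 1)\<close> from \<open>a (1, 2) * x 2\<close>, at 50.\<close>

lemma coeff_form_poly:
  "coeff (form_poly c) 48 = c (1, 2)" "coeff (form_poly c) 54 = c (1, 3)" "coeff (form_poly c) 60 = c (1, 4)"
  "coeff (form_poly c) 66 = c (1, 5)" "coeff (form_poly c) 90 = c (2, 3)" "coeff (form_poly c) 96 = c (2, 4)"
  "coeff (form_poly c) 102 = c (2, 5)" "coeff (form_poly c) 132 = c (3, 4)" "coeff (form_poly c) 138 = c (3, 5)"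
  "coeff (form_poly c) 174 = c (4, 5)"
  "coeff (form_poly c) 50 = c (0, 1)" "coeff (form_poly c) 49 = - c (0, 2)" "coeff (form_poly c) 55 = - c (0, 3)"
  "coeff (form_poly c) 61 = - c (0, 4)" "coeff (form_poly c) 67 = - c (0, 5)"
proof -
  have "form_poly c =
    smult (c (0,1)) (monom 1 50 + monom 1 57 + monom 1 64 + monom 1 71) +
    smult (c (0,2)) (monom 1 93 + monom 1 100 + monom 1 107 - monom 1 49) +
    smult (c (0,3)) (monom 1 136 + monom 1 143 - monom 1 55 - monom 1 92) +
    smult (c (0,4)) (monom 1 179 - monom 1 61 - monom 1 98 - monom 1 135) +
    smult (c (0,5)) (- monom 1 67 - monom 1 104 - monom 1 141 - monom 1 178) +
    monom (c (1,2)) 48 + monom (c (1,3)) 54 + monom (c (1,4)) 60 + monom (c (1,5)) 66 + monom (c (2,3)) 90 +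
    monom (c (2,4)) 96 + monom (c (2,5)) 102 + monom (c (3,4)) 132 + monom (c (3,5)) 138 + monom (c (4,5)) 174"
    unfolding form_poly_def upper_entries_6
    by (simp add: skew_ext_simps mult_monom smult_monom algebra_simps del: One_nat_def)
  note this[simp]
  show "coeff (form_poly c) 48 = c (1, 2)" "coeff (form_poly c) 54 = c (1, 3)" "coeff (form_poly c) 60 = c (1, 4)"
  "coeff (form_poly c) 66 = c (1, 5)" "coeff (form_poly c) 90 = c (2, 3)" "coeff (form_poly c) 96 = c (2, 4)"
  "coeff (form_poly c) 102 = c (2, 5)" "coeff (form_poly c) 132 = c (3, 4)" "coeff (form_poly c) 138 = c (3, 5)"
  "coeff (form_poly c) 174 = c (4, 5)"
  "coeff (form_poly c) 50 = c (0, 1)" "coeff (form_poly c) 49 = - c (0, 2)" "coeff (form_poly c) 55 = - c (0, 3)"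
  "coeff (form_poly c) 61 = - c (0, 4)" "coeff (form_poly c) 67 = - c (0, 5)"
    by (simp_all del: One_nat_def)
qed

lemma form_poly_eq_0:
  assumes "form_poly c = 0" "v \<in> upper_entries 6"
  shows "c v = 0"
  using assms(2) coeff_form_poly[of c] unfolding assms(1) upper_entries_6 coeff_0 by auto

subsection \<open>Product rank\<close>

lemma finite_upper_entries: "finite (upper_entries m)"
  by (rule finite_subset[of _ "{..<m} \<times> {..<m}"]) (auto simp: upper_entries_def)

lemma linear_form_scaled_Var:
  assumes "finite V" "v \<in> V"
  shows "linear_form V (Const a * Var v)"
  unfolding linear_form_def
proof (intro exI)
  have "(\<Sum>u\<in>V. Const (if u = v then a else 0) * Var u) = (\<Sum>u\<in>V. if u = v then Const a * Var u else 0)"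
    by (intro sum.cong) (auto simp: Const_def)
  then show "Const a * Var v = (\<Sum>u\<in>V. Const (if u = v then a else 0) * Var u)"
    using assms by simp
qed

lemma pfaffian_term_product_of_linear_forms:
  assumes p: "p \<in> matching_perms (Suc n)"
  shows "product_of_linear_forms (upper_entries (2 * Suc n)) (Suc n)
    (of_int (sign p) * (\<Prod>i<Suc n. generic_skew (p (2*i)) (p (2*i + 1))) :: (nat \<times> nat, 'a::comm_ring_1) mpoly)"
proof -
  \<comment> \<open>The sign is absorbed into the first linear form.\<close>
  define l :: "nat \<Rightarrow> (nat \<times> nat, 'a) mpoly" where
    "l j = Const (if j = 0 then of_int (sign p) else 1) * Var (p (2*j), p (2*j + 1))" for j
  have perm: "p permutes {..<2 * Suc n}" and lt: "p (2*j) < p (2*j + 1)" if "j < Suc n" for j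
    using p that by (auto simp: matching_perms_def)
  have mem: "(p (2*j), p (2*j + 1)) \<in> upper_entries (2 * Suc n)" if "j < Suc n" for j
  proof -
    have "2*j + 1 < 2 * Suc n" using that by presburger
    then show ?thesis
      using permutes_in_image[OF perm[of 0], of "2*j + 1"] lt[OF that] by (simp add: upper_entries_def)
  qed
  have one: "Const (1::'a) = (1 :: (nat \<times> nat, 'a) mpoly)" by (simp add: Const_def)
  have "(\<Prod>j<Suc n. l j) = l 0 * (\<Prod>j<n. l (Suc j))" by (rule prod.lessThan_Suc_shift)
  also have "\<dots> = of_int (sign p) * (\<Prod>i<Suc n. Var (p (2*i), p (2*i + 1)))"
    by (subst prod.lessThan_Suc_shift) (simp add: l_def one mult.assoc, simp add: Const_def)
  also have "(\<Prod>i<Suc n. Var (p (2*i), p (2*i + 1))) = (\<Prod>i<Suc n. generic_skew (p (2*i)) (p (2*i + 1)))"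
    by (intro prod.cong refl) (use lt in \<open>simp add: generic_skew_def\<close>)
  finally have eq: "(\<Prod>j<Suc n. l j) = of_int (sign p) * (\<Prod>i<Suc n. generic_skew (p (2*i)) (p (2*i + 1)))" .
  have "linear_form (upper_entries (2 * Suc n)) (l j)" if "j < Suc n" for j
    unfolding l_def using finite_upper_entries mem[OF that] by (rule linear_form_scaled_Var)
  then show ?thesis
    unfolding product_of_linear_forms_def using eq[symmetric] by blast
qed

text \<open>The \<open>LEAST\<close> in \<open>product_rank\<close> is meaningful only if some
  decomposition exists; the terms of the Pfaffian provide one.\<close>

lemma product_rank_attained:
  fixes f :: "(nat \<times> nat, 'a::field) mpoly"
  assumes f: "f = pfaffian (Suc n) generic_skew" and V: "V = upper_entries (2 * Suc n)"
  obtains g where "\<And>i. i < product_rank V (Suc n) f \<Longrightarrow> product_of_linear_forms V (Suc n) (g i)"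
    "f = (\<Sum>i<product_rank V (Suc n) f. g i)"
proof -
  have "finite (matching_perms (Suc n))"
    by (rule finite_subset[OF _ finite_permutations[of "{..<2 * Suc n}"]]) (auto simp: matching_perms_def)
  then obtain h where h: "bij_betw h {0..<card (matching_perms (Suc n))} (matching_perms (Suc n))"
    using ex_bij_betw_nat_finite by blast
  let ?T = "\<lambda>p. of_int (sign p) * (\<Prod>i<Suc n. generic_skew (p (2*i)) (p (2*i + 1))) :: (nat \<times> nat, 'a) mpoly"
  have f_sum: "f = (\<Sum>i<card (matching_perms (Suc n)). ?T (h i))"
    unfolding f pfaffian_def lessThan_atLeast0
    by (rule sum.reindex_bij_betw[OF h, symmetric])
  have prods: "\<forall>i<card (matching_perms (Suc n)). product_of_linear_forms V (Suc n) (?T (h i))"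
    unfolding V by (intro allI impI pfaffian_term_product_of_linear_forms) (use bij_betwE[OF h] in simp)
  have "\<exists>g. (\<forall>i<card (matching_perms (Suc n)). product_of_linear_forms V (Suc n) (g i)) \<and>
      f = (\<Sum>i<card (matching_perms (Suc n)). g i)"
    by (rule exI[of _ "\<lambda>i. ?T (h i)"]) (rule conjI[OF prods f_sum])
  then have "\<exists>(r::nat) g. (\<forall>i<r. product_of_linear_forms V (Suc n) (g i)) \<and> f = (\<Sum>i<r. g i)" by blast
  then have "\<exists>g. (\<forall>i<product_rank V (Suc n) f. product_of_linear_forms V (Suc n) (g i)) \<and>
      f = (\<Sum>i<product_rank V (Suc n) f. g i)"
    unfolding product_rank_def by (rule LeastI_ex)
  then show ?thesis using that by blast
qed

lemma eval_linear_form: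
  assumes "linear_form V l"
  obtains c where "\<And>\<rho>. eval_mpoly \<rho> l = (\<Sum>v\<in>V. c v * \<rho> v)"
  using assms by (auto simp: linear_form_def eval_mpoly_sum eval_mpoly_mult)

lemma eval_sum_of_products:
  fixes g :: "nat \<Rightarrow> ('v, 'a::comm_ring_1) mpoly"
  assumes "\<And>i. i < r \<Longrightarrow> product_of_linear_forms V d (g i)"
  shows "\<exists>c. \<forall>\<rho>. eval_mpoly \<rho> (\<Sum>i<r. g i) = (\<Sum>i<r. \<Prod>j<d. \<Sum>v\<in>V. c i j v * \<rho> v)"
proof -
  have "\<forall>i. \<exists>l. i < r \<longrightarrow> (\<forall>j<d. linear_form V (l j)) \<and> g i = (\<Prod>j<d. l j)"
    using assms by (auto simp: product_of_linear_forms_def)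
  then obtain l where l: "\<And>i j. i < r \<Longrightarrow> j < d \<Longrightarrow> linear_form V (l i j)"
    "\<And>i. i < r \<Longrightarrow> g i = (\<Prod>j<d. l i j)" by metis
  have "\<forall>i j. \<exists>c. i < r \<longrightarrow> j < d \<longrightarrow> (\<forall>\<rho>. eval_mpoly \<rho> (l i j) = (\<Sum>v\<in>V. c v * \<rho> v))"
    using l(1) eval_linear_form by metis
  then obtain c where c: "\<And>i j \<rho>. i < r \<Longrightarrow> j < d \<Longrightarrow> eval_mpoly \<rho> (l i j) = (\<Sum>v\<in>V. c i j v * \<rho> v)"
    by metis
  have "eval_mpoly \<rho> (\<Sum>i<r. g i) = (\<Sum>i<r. \<Prod>j<d. \<Sum>v\<in>V. c i j v * \<rho> v)" for \<rho>
    by (simp add: eval_mpoly_sum l(2) eval_mpoly_prod c)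
  then show ?thesis by blast
qed

section \<open>Six products do not suffice\<close>

lemma pf6_not_sum_of_products:
  fixes c :: "6 \<Rightarrow> 3 \<Rightarrow> nat \<times> nat \<Rightarrow> 'a::alg_closed_field"
  defines "L \<equiv> \<lambda>\<rho> i j. \<Sum>v\<in>upper_entries 6. c i j v * \<rho> v"
  assumes rep: "\<And>\<rho>. pf6 \<rho> = (\<Sum>i\<in>UNIV. L \<rho> i 1 * L \<rho> i 2 * L \<rho> i 3)"
  shows False
proof -
  \<comment> \<open>If one \<open>form_poly (c i j)\<close> is 0, then that form and the whole
    product vanish, so \<Lambda> may put 0 for all three forms without changing the cubic.\<close>
  define good where "good i \<longleftrightarrow> (\<forall>j. form_poly (c i j) \<noteq> 0)" for i
  define \<Lambda> :: "(nat \<times> nat \<Rightarrow> 'a) \<Rightarrow> 'a ^ (6 \<times> 3)" where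
    "\<Lambda> \<rho> = (\<chi> p. if good (fst p) then L \<rho> (fst p) (snd p) else 0)" for \<rho>
  have L_0: "L \<rho> i j = 0" if "form_poly (c i j) = 0" for \<rho> i j
    unfolding L_def using form_poly_eq_0[OF that] by simp
  have pf: "pf6 \<rho> = (\<Sum>i\<in>UNIV. \<Lambda> \<rho> $ (i,1) * \<Lambda> \<rho> $ (i,2) * \<Lambda> \<rho> $ (i,3))" for \<rho>
    unfolding rep
  proof (rule sum.cong[OF refl])
    fix i
    show "L \<rho> i 1 * L \<rho> i 2 * L \<rho> i 3 = \<Lambda> \<rho> $ (i,1) * \<Lambda> \<rho> $ (i,2) * \<Lambda> \<rho> $ (i,3)"
      using L_0[of i] by (auto simp: \<Lambda>_def good_def forall_3)
  qed
  have L_add: "\<Lambda> (\<lambda>v. \<rho> v + \<sigma> v) = \<Lambda> \<rho> + \<Lambda> \<sigma>" for \<rho> \<sigma>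
    by (simp add: \<Lambda>_def L_def vec_eq_iff distrib_left sum.distrib)
  have L_scale: "\<Lambda> (\<lambda>v. a * \<rho> v) = a *s \<Lambda> \<rho>" for \<rho> a
    by (simp add: \<Lambda>_def L_def vec_eq_iff sum_distrib_left mult_ac)
  \<comment> \<open>A nonroot of the product is a parameter at which none of the nonzero forms
    vanishes on the curve.\<close>
  define q where "q = (\<Prod>p\<in>{p. form_poly (c (fst p) (snd p)) \<noteq> 0}. form_poly (c (fst p) (snd p)))"
  have "q \<noteq> 0" by (simp add: q_def)
  then obtain t where t: "poly q t \<noteq> 0" by (rule alg_closed_ex_nonroot)
  have nonroot: "poly (form_poly (c i j)) t \<noteq> 0" if "form_poly (c i j) \<noteq> 0" for i j
    using t that by (auto simp: q_def poly_prod)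
  define F where "F a = \<Lambda> (skew_ext (\<lambda>k. t ^ k) a)" for a
  define W where "W = range F"
  \<comment> \<open>The point of the curve at parameter \<open>t\<close>: for good \<open>i\<close>
    its coordinates are the values of \<open>form_poly (c i j)\<close> at \<open>t\<close>.\<close>
  define x0 where "x0 = F (\<lambda>(i, j). t ^ (36 * i + 6 * j))"
  have F_add: "F (\<lambda>v. a v + b v) = F a + F b" for a b
    by (simp add: F_def skew_ext_add L_add[symmetric])
  have F_scale: "F (\<lambda>v. s * a v) = s *s F a" for s a
    by (simp add: F_def skew_ext_scale L_scale[symmetric])
  have F_0: "F (\<lambda>_. 0) = 0"
    using F_scale[of 0 "\<lambda>_. 0"] by simp
  have W: "vec.subspace W"
    unfolding W_def vec.subspace_def
    using F_0 by (auto simp: F_add[symmetric] F_scale[symmetric] image_iff)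
  have "2 * vec.dim W \<le> 3 * CARD(6)"
  proof (rule dim_cubic_subspace[OF W, of x0])
    show "(\<Sum>i\<in>UNIV. x $ (i,1) * x $ (i,2) * x $ (i,3)) = 0" if "x \<in> W" for x
      using that pf[symmetric] by (auto simp: W_def F_def pf6_skew_ext)
    show "x $ (i,k) = 0" if "x0 $ (i,j) = 0" "x \<in> W" for x i j k
    proof -
      have "\<not> good i"
      proof
        assume "good i"
        then have "x0 $ (i,j) = poly (form_poly (c i j)) t"
          by (simp add: x0_def F_def \<Lambda>_def L_def poly_form_poly)
        then show False using that(1) nonroot[of i j] \<open>good i\<close> by (simp add: good_def)
      qed
      then show ?thesis using that(2) by (auto simp: W_def F_def \<Lambda>_def)
    qed
  qed (simp add: x0_def W_def)
  moreover have "10 \<le> vec.dim W"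
  proof -
    \<comment> \<open>With the kernel vector fixed, the ten entries outside row 0 are free
      parameters.\<close>
    let ?P = "{v \<in> upper_entries 6. fst v \<noteq> 0}"
    have "?P = {(1,2),(1,3),(1,4),(1,5),(2,3),(2,4),(2,5),(3,4),(3,5),(4,5)}"
      unfolding Collect_conj_eq Collect_mem_eq upper_entries_6 by (simp add: Int_insert_left)
    then have "finite ?P" "card ?P = CARD(10)" by simp_all
    then obtain \<beta> where \<beta>: "bij_betw \<beta> ?P (UNIV :: 10 set)"
      using finite_same_card_bij[of ?P "UNIV :: 10 set"] by auto
    define G :: "'a ^ 10 \<Rightarrow> 'a ^ (6 \<times> 3)" where "G u = F (\<lambda>v. u $ \<beta> v)" for u
    have lin: "Vector_Spaces.linear (*s) (*s) G"
      by (rule vec_linearI) (simp_all add: G_def F_add F_scale)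
    interpret G: Vector_Spaces.linear "(*s)" "(*s)" G by (rule lin)
    have "u = 0" if "G u = 0" for u
    proof -
      let ?\<rho> = "skew_ext (\<lambda>k. t ^ k) (\<lambda>v. u $ \<beta> v)"
      \<comment> \<open>The Pfaffian depends on a matrix only through \<Lambda>, which is additive
        and vanishes at \<open>?\<rho>\<close>.\<close>
      have "pf6 (\<lambda>v. ?\<rho> v + \<sigma> v) = pf6 \<sigma>" for \<sigma>
        using that by (simp add: pf L_add G_def F_def)
      then have "?\<rho> (i, j) = 0" if "(i, j) \<in> upper_entries 6" "i \<noteq> 0" for i j
        using pf6_concise[of ?\<rho>] that by blast
      then have zero: "u $ \<beta> v = 0" if "v \<in> ?P" for v
        using that by (cases v) (simp add: skew_ext_simps(1))
      have "u $ k = 0" for k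
      proof -
        have "k \<in> \<beta> ` ?P" using \<beta> by (simp add: bij_betw_def)
        then show ?thesis using zero by blast
      qed
      then show ?thesis by (simp add: vec_eq_iff)
    qed
    then have "inj G" by (subst G.inj_iff_eq_0) auto
    then have "vec.dim (range G) = vec.dim (UNIV :: ('a ^ 10) set)"
      using vec.dim_image_eq[OF lin, of UNIV] by (simp add: vec.span_UNIV)
    also have "\<dots> = 10" by (simp add: vec_dim_card del: vec.dim_UNIV)
    finally show ?thesis
      using vec.dim_subset[of "range G" W] by (auto simp: W_def G_def)
  qed
  ultimately show False by simp
qed

theorem mainTheorem4:
  fixes f :: "(nat \<times> nat, 'a::alg_closed_field) mpoly"
  assumes "f = pfaffian 3 generic_skew"
  shows "product_rank (upper_entries 6) 3 f \<ge> 7"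
proof (rule ccontr)
  define r where "r = product_rank (upper_entries 6) 3 f"
  assume "\<not> 7 \<le> product_rank (upper_entries 6) 3 f"
  then have r: "r \<le> 6" by (simp add: r_def)
  have eqs: "Suc 2 = (3::nat)" "2 * 3 = (6::nat)" by simp_all
  obtain g where g: "\<And>i. i < r \<Longrightarrow> product_of_linear_forms (upper_entries 6) 3 (g i)" "f = (\<Sum>i<r. g i)"
    using product_rank_attained[of f 2, unfolded eqs, OF assms refl] unfolding r_def by blast
  obtain c :: "nat \<Rightarrow> nat \<Rightarrow> nat \<times> nat \<Rightarrow> 'a" where
    "\<forall>\<rho>. eval_mpoly \<rho> (\<Sum>i<r. g i) = (\<Sum>i<r. \<Prod>j<3. \<Sum>v\<in>upper_entries 6. c i j v * \<rho> v)"
    using eval_sum_of_products[of r "upper_entries 6" 3 g, OF g(1)] by blast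
  then have c: "\<And>\<rho>. eval_mpoly \<rho> f = (\<Sum>i<r. \<Prod>j<3. \<Sum>v\<in>upper_entries 6. c i j v * \<rho> v)"
    using g(2) by simp
  have "card {..<6::nat} = CARD(6)" by simp
  then obtain h where h: "bij_betw h (UNIV :: 6 set) {..<6::nat}"
    using finite_same_card_bij[of "UNIV :: 6 set" "{..<6::nat}"] by auto
  define m :: "3 \<Rightarrow> nat" where "m j = (if j = 1 then 0 else if j = 2 then 1 else 2)" for j
  \<comment> \<open>Zero products pad a shorter decomposition to exactly six.\<close>
  define c' where "c' i j v = (if h i < r then c (h i) (m j) v else 0)" for i j v
  show False
  proof (rule pf6_not_sum_of_products[of c'])
    fix \<rho> :: "nat \<times> nat \<Rightarrow> 'a"
    let ?T = "\<lambda>i. if i < r then \<Prod>j<3. \<Sum>v\<in>upper_entries 6. c i j v * \<rho> v else 0"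
    have "pf6 \<rho> = (\<Sum>i<r. \<Prod>j<3. \<Sum>v\<in>upper_entries 6. c i j v * \<rho> v)"
      using c[of \<rho>] assms by (simp add: eval_pfaffian_3)
    also have "\<dots> = (\<Sum>i<6. ?T i)"
      using r by (intro sum.mono_neutral_cong_left) auto
    also have "\<dots> = (\<Sum>i\<in>UNIV. ?T (h i))"
      by (rule sum.reindex_bij_betw[OF h, symmetric])
    also have "\<dots> = (\<Sum>i\<in>UNIV. (\<Sum>v\<in>upper_entries 6. c' i 1 v * \<rho> v) * (\<Sum>v\<in>upper_entries 6. c' i 2 v * \<rho> v) *
         (\<Sum>v\<in>upper_entries 6. c' i 3 v * \<rho> v))"
      by (intro sum.cong refl) (simp add: c'_def m_def numeral_3_eq_3 numeral_2_eq_2 lessThan_Suc)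
    finally show "pf6 \<rho> = (\<Sum>i\<in>UNIV. (\<Sum>v\<in>upper_entries 6. c' i 1 v * \<rho> v) * (\<Sum>v\<in>upper_entries 6. c' i 2 v * \<rho> v) *
         (\<Sum>v\<in>upper_entries 6. c' i 3 v * \<rho> v))" .
  qed
qed

end
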